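(* Fix the clause size $k$. There is a sufficiently large constant $c=c(k)$ such that the following holds for every $m=m(n)$ with $m/n\ge c\log n$. Let $F$ be a random $k$-CNF formula drawn from $\mathcal{P}^{\rm sat}_{n,m}$. Then with high probability $F$ has only one satisfying assignment.
   Context: A $k$-clause over the variables $x_1,\dots,x_n$ is a disjunction of $k$ literals on $k$ distinct variables; there are $2^k\binom nk$ of them. The distribution $\mathcal{P}^{\rm sat}_{n,m}$ over satisfiable $k$-CNF formulas (for $m\le 2^k\binom nk$) is defined as follows: take a uniformly random permutation of all $2^k\binom nk$ clauses; starting from the empty formula, scan the first $m$ clauses in the order of the permutation, including each scanned clause if and only if the formula remains satisfiable after its addition; the output is the formula obtained after scanning these $m$ clauses. "With high probability" means with probability tending to $1$ as $n\to\infty$. *)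

theory Defs
  imports "HOL-Probability.Probability" "HOL-Combinatorics.Multiset_Permutations"
begin

text \<open>
  The variables are \<open>1, \<dots>, n\<close>. The literal \<open>(x, True)\<close> is the variable \<open>x\<close>, and \<open>(x, False)\<close>
  is its negation. A clause is the set of its literals, and a CNF formula is the set of its clauses.
\<close>

type_synonym literal = "nat \<times> bool"
type_synonym clause = "literal set"
type_synonym cnf = "clause set"

definition k_clauses :: "nat \<Rightarrow> nat \<Rightarrow> clause set" where
  "k_clauses n k = {C. C \<subseteq> {1..n} \<times> UNIV \<and> card C = k \<and> inj_on fst C}"

text \<open>
  Assignments are extensional functions, so that two of them are equal if and only if they agree
  on the variables \<open>1, \<dots>, n\<close>.
\<close>

definition assignments :: "nat \<Rightarrow> (nat \<Rightarrow> bool) set" where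
  "assignments n = {1..n} \<rightarrow>\<^sub>E UNIV"

definition satisfies :: "(nat \<Rightarrow> bool) \<Rightarrow> cnf \<Rightarrow> bool" where
  "satisfies \<sigma> F \<longleftrightarrow> (\<forall>C\<in>F. \<exists>(x, b)\<in>C. \<sigma> x = b)"

definition satisfiable :: "nat \<Rightarrow> cnf \<Rightarrow> bool" where
  "satisfiable n F \<longleftrightarrow> (\<exists>\<sigma>\<in>assignments n. satisfies \<sigma> F)"

definition scan_clause :: "nat \<Rightarrow> clause \<Rightarrow> cnf \<Rightarrow> cnf" where
  "scan_clause n C F = (if satisfiable n (insert C F) then insert C F else F)"

definition scan :: "nat \<Rightarrow> clause list \<Rightarrow> cnf" where
  "scan n Cs = fold (scan_clause n) Cs {}"

text \<open>
  If \<open>m\<close> exceeds the number of \<open>k\<close>-clauses, then all clauses are scanned.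
\<close>

definition P_sat :: "nat \<Rightarrow> nat \<Rightarrow> nat \<Rightarrow> cnf pmf" where
  "P_sat k n m =
     map_pmf (\<lambda>Cs. scan n (take m Cs)) (pmf_of_set (permutations_of_set (k_clauses n k)))"

lemma finite_k_clauses: "finite (k_clauses n k)"
  by (rule finite_subset[of _ "Pow ({1..n} \<times> UNIV)"]) (auto simp: k_clauses_def)

lemma card_k_clauses: "card (k_clauses n k) = 2 ^ k * (n choose k)"
proof -
  define T where "T = (SIGMA V:{V. V \<subseteq> {1..n} \<and> card V = k}. Pow V)"
  define f :: "nat set \<times> nat set \<Rightarrow> clause" where "f = (\<lambda>(V, P). (\<lambda>x. (x, x \<in> P)) ` V)"
  have inj: "inj_on f T"
  proof (rule inj_on_inverseI[where g = "\<lambda>C. (fst ` C, {x. (x, True) \<in> C})"])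
    fix p assume "p \<in> T"
    then show "(fst ` f p, {x. (x, True) \<in> f p}) = p"
      by (auto simp: f_def T_def image_image)
  qed
  have "f ` T = k_clauses n k"
  proof (intro equalityI subsetI)
    fix C assume "C \<in> f ` T"
    then show "C \<in> k_clauses n k"
      by (auto simp: f_def T_def k_clauses_def card_image inj_on_def)
  next
    fix C assume C: "C \<in> k_clauses n k"
    define p where "p = (fst ` C, {x. (x, True) \<in> C})"
    have inj_C: "inj_on fst C" using C by (simp add: k_clauses_def)
    have "p \<in> T"
      using C card_image[OF inj_C] by (force simp: p_def T_def k_clauses_def)
    moreover have "f p = C"
    proof -
      have "(fst l, (fst l, True) \<in> C) = l" if "l \<in> C" for l
      proof (cases l)
        case (Pair x b)
        then show ?thesis
          using that inj_onD[OF inj_C, of "(x, True)" "(x, False)"] by (cases b) auto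
      qed
      then have "(\<lambda>l. (fst l, (fst l, True) \<in> C)) ` C = C" by simp
      then show ?thesis by (simp add: f_def p_def image_image)
    qed
    ultimately show "C \<in> f ` T" by blast
  qed
  then have "card (k_clauses n k) = card T"
    using card_image[OF inj] by simp
  also have "\<dots> = (\<Sum>V\<in>{V. V \<subseteq> {1..n} \<and> card V = k}. card (Pow V))"
    unfolding T_def by (rule card_SigmaI) (auto intro: finite_subset)
  also have "\<dots> = (\<Sum>V\<in>{V. V \<subseteq> {1..n} \<and> card V = k}. 2 ^ k)"
    by (rule sum.cong) (auto simp: card_Pow finite_subset)
  also have "\<dots> = 2 ^ k * (n choose k)"
    using n_subsets[of "{1..n}" k] by simp
  finally show ?thesis .
qed

end

theory Submission
  imports Defs "HOL-Real_Asymp.Real_Asymp"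
begin

text \<open>
  Every scanned clause satisfied by a survivor (a satisfying assignment of the current formula) is
  accepted, so any two survivors agree on all scanned clauses, whether accepted or not. By a union
  bound over the at most \<open>4 ^ n\<close> pairs \<open>(\<rho>, Z)\<close> with \<open>n/4 \<le> |Z| \<le> 3n/4\<close>, the first \<open>m/2\<close> clauses
  contain for each pair a clause whose only literal on \<open>Z\<close> is true under \<open>\<rho>\<close> and whose other literals
  are false. This forces any two survivors to differ in fewer than \<open>n/4\<close> variables and then, adding
  survivors one at a time, the set of all variables on which some survivors disagree to have fewer
  than \<open>n/4\<close> elements. The remaining variables are frozen, so each further clause freezes a given
  unfrozen variable with probability of order at least \<open>1/n\<close>, and, as for the coupon collector,
  another \<open>m/2\<close> clauses freeze all variables.
\<close>

section \<open>Random permutations avoiding a set\<close>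

lemma card_permutations_of_set_Cons:
  assumes "finite A" "A \<noteq> {}"
  shows "card {L \<in> permutations_of_set A. P L} =
    (\<Sum>x\<in>A. card {L \<in> permutations_of_set (A - {x}). P (x # L)})"
proof -
  have "{L \<in> permutations_of_set A. P L} =
      (\<Union>x\<in>A. (#) x ` {L \<in> permutations_of_set (A - {x}). P (x # L)})"
    using assms by (auto simp: permutations_of_set_nonempty)
  also have "card \<dots> = (\<Sum>x\<in>A. card ((#) x ` {L \<in> permutations_of_set (A - {x}). P (x # L)}))"
    using assms(1) by (intro card_UN_disjoint) auto
  also have "\<dots> = (\<Sum>x\<in>A. card {L \<in> permutations_of_set (A - {x}). P (x # L)})"
    by (intro sum.cong refl card_image) auto
  finally show ?thesis .
qed

text \<open>Condition on the first entry: it misses \<open>T\<close> with probability at most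
  \<open>1 - p * N / card A\<close>, which is at most \<open>exp (- p)\<close> because
  \<open>card A \<le> N\<close>. Deleting an entry outside \<open>T\<close> leaves \<open>T\<close>
  intact, and the separate \<open>N\<close> keeps the hypotheses stable while \<open>A\<close>
  shrinks.\<close>

lemma card_permutations_avoiding:
  fixes p :: real
  assumes "finite A" "T \<subseteq> A" "card A \<le> N" "0 < p * N" "p * N \<le> card T"
  shows "card {L \<in> permutations_of_set A. set (take m L) \<inter> T = {}} \<le> exp (- p * m) * fact (card A)"
  using assms
proof (induction m arbitrary: A)
  case 0
  then show ?case by simp
next
  case (Suc m)
  let ?E = "\<lambda>B m. {L \<in> permutations_of_set B. set (take m L) \<inter> T = {}}"
  let ?b = "exp (- p * m) * fact (card A - 1)"
  have T: "finite T" "T \<noteq> {}" using Suc.prems finite_subset by auto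
  then have A: "A \<noteq> {}" "card A > 0" using Suc.prems by (auto simp: card_gt_0_iff)
  have N: "real N > 0" using A Suc.prems(3) by simp
  have p: "p > 0" using Suc.prems(4) N by (simp add: zero_less_mult_iff)
  have step: "real (card {L \<in> permutations_of_set (A - {x}). set (take (Suc m) (x # L)) \<inter> T = {}})
      \<le> (if x \<in> T then 0 else ?b)" if x: "x \<in> A" for x
  proof (cases "x \<in> T")
    case False
    have "real (card (?E (A - {x}) m)) \<le> exp (- p * m) * fact (card (A - {x}))"
      using Suc.prems False x by (intro Suc.IH) (auto simp: card_Diff_singleton)
    with False x Suc.prems(1) show ?thesis by (simp add: card_Diff_singleton)
  qed simp
  have "real (card (?E A (Suc m))) =
      (\<Sum>x\<in>A. real (card {L \<in> permutations_of_set (A - {x}). set (take (Suc m) (x # L)) \<inter> T = {}}))"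
    using Suc.prems(1) A by (subst card_permutations_of_set_Cons) auto
  also have "\<dots> \<le> (\<Sum>x\<in>A. if x \<in> T then 0 else ?b)"
    by (intro sum_mono step)
  also have "\<dots> = (\<Sum>x\<in>A - T. ?b)"
    using Suc.prems(1) by (intro sum.mono_neutral_cong_right) auto
  also have "\<dots> = (real (card A) - card T) * ?b"
    using Suc.prems(1,2) T(1) by (simp add: card_Diff_subset card_mono of_nat_diff)
  also have "\<dots> \<le> (exp (- p) * card A) * ?b"
  proof (rule mult_right_mono)
    have "real (card A) - card T \<le> card A - p * N" using Suc.prems(5) by simp
    also have "\<dots> \<le> (1 - p) * card A"
      using Suc.prems(3) p by (simp add: algebra_simps)
    also have "\<dots> \<le> exp (- p) * card A"
      using exp_ge_add_one_self[of "-p"] by (intro mult_right_mono) auto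
    finally show "real (card A) - card T \<le> exp (- p) * card A" .
  qed simp
  also have "\<dots> = exp (- p * Suc m) * fact (card A)"
    using A by (simp add: fact_reduce[of "card A"] exp_add[symmetric] algebra_simps)
  finally show ?case .
qed

text \<open>The target may depend on the first \<open>l\<close> entries as long as it contains none
  of them. Peeling these entries off one by one, with \<open>Q\<close> and \<open>T\<close>
  absorbing each, reduces to a fixed target.\<close>

lemma card_permutations_avoiding_later:
  fixes p :: real
  assumes "finite A" "card A \<le> N" "0 < p * N"
    and "\<And>K. Q K \<Longrightarrow> T K \<subseteq> A - set K \<and> p * N \<le> card (T K)"
  shows "card {L \<in> permutations_of_set A.
           Q (take l L) \<and> set (take m (drop l L)) \<inter> T (take l L) = {}}
         \<le> exp (- p * m) * fact (card A)"
  using assms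
proof (induction l arbitrary: A Q T)
  case 0
  show ?case
  proof (cases "Q []")
    case True
    with 0 card_permutations_avoiding[of A "T []" N p m] show ?thesis by force
  qed simp
next
  case (Suc l)
  let ?E = "\<lambda>B l Q T. {L \<in> permutations_of_set B.
    Q (take l L) \<and> set (take m (drop l L)) \<inter> T (take l L) = {}}"
  show ?case
  proof (cases "A = {}")
    case True
    \<comment> \<open>\<open>Q []\<close> would put a target of positive size inside the empty
      set.\<close>
    have "\<not> Q []" using Suc.prems(3) Suc.prems(4)[of "[]"] True by auto
    with True show ?thesis by (simp cong: conj_cong)
  next
    case False
    have "real (card (?E A (Suc l) Q T)) =
        (\<Sum>x\<in>A. real (card (?E (A - {x}) l (\<lambda>K. Q (x # K)) (\<lambda>K. T (x # K)))))"
      using Suc.prems(1) False by (subst card_permutations_of_set_Cons) auto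
    also have "\<dots> \<le> (\<Sum>x\<in>A. exp (- p * m) * fact (card A - 1))"
    proof (rule sum_mono)
      fix x assume x: "x \<in> A"
      have "real (card (?E (A - {x}) l (\<lambda>K. Q (x # K)) (\<lambda>K. T (x # K))))
          \<le> exp (- p * m) * fact (card (A - {x}))"
      proof (rule Suc.IH)
        show "T (x # K) \<subseteq> A - {x} - set K \<and> p * N \<le> card (T (x # K))" if "Q (x # K)" for K
          using Suc.prems(4)[OF that] by auto
      qed (use Suc.prems x in \<open>auto simp: card_Diff_singleton\<close>)
      with x Suc.prems(1) show "real (card (?E (A - {x}) l (\<lambda>K. Q (x # K)) (\<lambda>K. T (x # K))))
          \<le> exp (- p * m) * fact (card A - 1)"
        by (simp add: card_Diff_singleton)
    qed
    also have "\<dots> = exp (- p * m) * fact (card A)"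
      using False Suc.prems(1) by (simp add: fact_reduce[of "card A"] card_gt_0_iff)
    finally show ?thesis .
  qed
qed

lemma prob_permutation_avoiding_later:
  fixes p :: real
  assumes "finite A" "0 < p * card A"
    and "\<And>K. Q K \<Longrightarrow> T K \<subseteq> A - set K \<and> p * card A \<le> card (T K)"
  shows "measure_pmf.prob (pmf_of_set (permutations_of_set A))
      {L. Q (take l L) \<and> set (take m (drop l L)) \<inter> T (take l L) = {}} \<le> exp (- p * m)"
proof -
  have "permutations_of_set A \<inter> {L. Q (take l L) \<and> set (take m (drop l L)) \<inter> T (take l L) = {}} =
    {L \<in> permutations_of_set A. Q (take l L) \<and> set (take m (drop l L)) \<inter> T (take l L) = {}}"
    by auto
  then show ?thesis
    using card_permutations_avoiding_later[OF assms(1) order_refl assms(2), of Q T l m] assms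
    by (simp add: measure_pmf_of_set divide_le_eq)
qed

section \<open>Surviving assignments\<close>

definition sols :: "nat \<Rightarrow> clause list \<Rightarrow> (nat \<Rightarrow> bool) set" where
  "sols n Cs = {\<sigma> \<in> assignments n. satisfies \<sigma> (scan n Cs)}"

lemma scan_append: "scan n (Cs @ Ds) = fold (scan_clause n) Ds (scan n Cs)"
  by (simp add: scan_def)

lemma scan_subset_append: "scan n Cs \<subseteq> scan n (Cs @ Ds)"
proof (induction Ds rule: rev_induct)
  case (snoc C Ds)
  have "scan n (Cs @ Ds) \<subseteq> scan n ((Cs @ Ds) @ [C])"
    unfolding scan_append[of n "Cs @ Ds"] by (auto simp: scan_clause_def)
  with snoc show ?case by simp
qed simp

lemma sols_append_subset: "sols n (Cs @ Ds) \<subseteq> sols n Cs"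
  using scan_subset_append[of n Cs Ds] by (auto simp: sols_def satisfies_def)

lemma sols_nonempty: "sols n Cs \<noteq> {}"
proof -
  have "satisfiable n (scan n Cs)"
  proof (induction Cs rule: rev_induct)
    case Nil
    have "restrict (\<lambda>_. True) {1..n} \<in> assignments n" by (simp add: assignments_def)
    then show ?case by (auto simp: scan_def satisfiable_def satisfies_def)
  next
    case (snoc C Cs)
    then show ?case by (simp add: scan_append scan_clause_def)
  qed
  then show ?thesis by (auto simp: satisfiable_def sols_def)
qed

lemma finite_assignments: "finite (assignments n)"
  by (simp add: assignments_def finite_PiE)

lemma finite_sols: "finite (sols n Cs)"
  using finite_assignments[of n] by (simp add: sols_def)

text \<open>A scanned clause satisfied by a survivor was accepted, as that survivor witnessed
  satisfiability; hence all survivors satisfy it.\<close>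

lemma sols_agree:
  assumes \<sigma>: "\<sigma> \<in> sols n Cs" and \<tau>: "\<tau> \<in> sols n Cs" and "C \<in> set Cs" and sat: "satisfies \<sigma> {C}"
  shows "satisfies \<tau> {C}"
proof -
  obtain Xs Ys where Cs: "Cs = (Xs @ [C]) @ Ys"
    using split_list[OF \<open>C \<in> set Cs\<close>] by auto
  have "\<sigma> \<in> sols n Xs"
    using \<sigma> sols_append_subset[of n Xs "C # Ys"] by (auto simp: Cs)
  then have "satisfiable n (insert C (scan n Xs))"
    using sat by (auto simp: satisfiable_def sols_def satisfies_def)
  then have "C \<in> scan n (Xs @ [C])"
    by (simp add: scan_append scan_clause_def)
  then have "C \<in> scan n Cs"
    using scan_subset_append[of n "Xs @ [C]" Ys] by (auto simp: Cs)
  with \<tau> show ?thesis by (auto simp: sols_def satisfies_def)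
qed

section \<open>Clauses with a single true literal\<close>

text \<open>An assignment that agrees with \<open>\<rho>\<close> on \<open>V\<close> satisfies such
  a clause exactly if it also agrees with \<open>\<rho>\<close> at \<open>x\<close>. These clauses
  therefore separate two assignments that agree with \<open>\<rho>\<close> on \<open>V\<close> but
  differ at \<open>x\<close>.\<close>

definition hit :: "(nat \<Rightarrow> bool) \<Rightarrow> nat set \<Rightarrow> nat set \<Rightarrow> nat \<Rightarrow> clause set" where
  "hit \<rho> X W j = (\<lambda>(x, V). insert (x, \<rho> x) ((\<lambda>y. (y, \<not> \<rho> y)) ` V)) `
     (X \<times> {V. V \<subseteq> W \<and> card V = j})"

lemma hitE:
  assumes "C \<in> hit \<rho> X W j"
  obtains x V where "x \<in> X" "V \<subseteq> W" "card V = j" "C = insert (x, \<rho> x) ((\<lambda>y. (y, \<not> \<rho> y)) ` V)"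
  using assms by (auto simp: hit_def)

lemma hit_subset_k_clauses:
  assumes "X \<subseteq> {1..n}" "W \<subseteq> {1..n}" "X \<inter> W = {}"
  shows "hit \<rho> X W j \<subseteq> k_clauses n (Suc j)"
proof
  fix C assume "C \<in> hit \<rho> X W j"
  then obtain x V where C: "x \<in> X" "V \<subseteq> W" "card V = j"
      "C = insert (x, \<rho> x) ((\<lambda>y. (y, \<not> \<rho> y)) ` V)"
    by (rule hitE)
  have "finite V"
    using C(2) assms(2) by (meson finite_atLeastAtMost finite_subset)
  moreover have "card ((\<lambda>y. (y, \<not> \<rho> y)) ` V) = j"
    using C(3) by (subst card_image) (auto simp: inj_on_def)
  moreover have "(x, \<rho> x) \<notin> (\<lambda>y. (y, \<not> \<rho> y)) ` V" by auto
  ultimately have "card C = Suc j" by (simp add: C(4))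
  moreover have "inj_on fst C" unfolding C(4) inj_on_def using C(1,2) assms(3) by fastforce
  moreover have "C \<subseteq> {1..n} \<times> UNIV"
    unfolding C(4) using C(1,2) assms(1,2) by blast
  ultimately show "C \<in> k_clauses n (Suc j)" by (simp add: k_clauses_def)
qed

lemma card_hit:
  assumes "finite X" "finite W" "X \<inter> W = {}"
  shows "card (hit \<rho> X W j) = card X * (card W choose j)"
proof -
  have "card (hit \<rho> X W j) = card (X \<times> {V. V \<subseteq> W \<and> card V = j})"
    unfolding hit_def
  proof (intro card_image inj_on_inverseI)
    fix p assume p: "p \<in> X \<times> {V. V \<subseteq> W \<and> card V = j}"
    obtain x V where xV: "p = (x, V)" by force
    have "x \<in> X" "V \<subseteq> W" using p xV by auto
    then have "X \<inter> insert x V = {x}" "insert x V - X = V" using assms(3) by auto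
    \<comment> \<open>The variables of the clause inside \<open>X\<close> give back
      \<open>x\<close>, the remaining ones give back \<open>V\<close>.\<close>
    then show "(\<lambda>C. (the_elem (X \<inter> fst ` C), fst ` C - X))
        ((\<lambda>(x, V). insert (x, \<rho> x) ((\<lambda>y. (y, \<not> \<rho> y)) ` V)) p) = p"
      by (simp add: xV image_image)
  qed
  also have "\<dots> = card X * (card W choose j)"
    using assms n_subsets[OF assms(2)] by (simp add: card_cartesian_product)
  finally show ?thesis .
qed

text \<open>The \<open>j\<close>-th power accounts for choosing \<open>j\<close> false literals on
  at least \<open>n / 4\<close> variables, the factor \<open>2 ^ Suc j\<close> for the sign patterns
  of a general clause.\<close>

definition hit_rate :: "nat \<Rightarrow> real" where
  "hit_rate j = (1 / (4 * Suc j)) ^ j / 2 ^ Suc j"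

lemma hit_rate_pos: "hit_rate j > 0"
  by (simp add: hit_rate_def)

text \<open>Compare \<open>card X * (card W choose j)\<close> with
  \<open>2 ^ Suc j * (n choose Suc j)\<close>, bounding the first binomial below by
  \<open>(card W / j) ^ j\<close> and the second above by \<open>n ^ Suc j\<close>. The assumption
  \<open>4 * j \<le> n\<close> ensures \<open>j \<le> card W\<close>.\<close>

lemma card_hit_ge:
  assumes "X \<subseteq> {1..n}" "W \<subseteq> {1..n}" "X \<inter> W = {}" "n \<le> 4 * card W" "4 * j \<le> n" "n > 0"
  shows "hit_rate j * card X / n * card (k_clauses n (Suc j)) \<le> card (hit \<rho> X W j)"
proof -
  have fin: "finite X" "finite W"
    using assms(1,2) by (meson finite_atLeastAtMost finite_subset)+
  have jW: "j \<le> card W" using assms by linarith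
  have W: "(real n / (4 * Suc j)) ^ j \<le> real (card W choose j)"
  proof (cases "j = 0")
    case False
    have "real n / (4 * Suc j) \<le> real (4 * card W) / (4 * j)"
      using assms(4) False by (intro frac_le) auto
    also have "\<dots> = real (card W) / real j" by simp
    finally have "(real n / (4 * Suc j)) ^ j \<le> (real (card W) / real j) ^ j"
      by (intro power_mono) auto
    also have "\<dots> \<le> real (card W choose j)"
      by (rule binomial_ge_n_over_k_pow_k[OF jW])
    finally show ?thesis .
  qed simp
  have le: "real (n choose Suc j) \<le> real n ^ Suc j"
  proof (cases "Suc j \<le> n")
    case True
    have "real (n choose Suc j) \<le> real (n ^ Suc j)"
      using binomial_le_pow[OF True] by (rule of_nat_mono)
    then show ?thesis by simp
  qed (simp add: binomial_eq_0)
  have "hit_rate j * card X / n * card (k_clauses n (Suc j)) =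
      hit_rate j * card X / n * 2 ^ Suc j * real (n choose Suc j)"
    by (simp add: card_k_clauses)
  also have "\<dots> \<le> hit_rate j * card X / n * 2 ^ Suc j * real n ^ Suc j"
    using hit_rate_pos[of j] by (intro mult_left_mono le) auto
  also have "\<dots> = card X * (real n / (4 * Suc j)) ^ j"
    using assms(6) by (simp add: hit_rate_def power_divide field_simps del: of_nat_Suc)
  also have "\<dots> \<le> card X * real (card W choose j)"
    by (intro mult_left_mono W) auto
  also have "\<dots> = card (hit \<rho> X W j)"
    using fin assms(3) by (simp add: card_hit)
  finally show ?thesis .
qed

section \<open>Frozen variables\<close>

text \<open>Since \<open>Z\<close> and its complement both have at least \<open>n / 4\<close>
  elements, each of these sets of clauses is a constant fraction of all clauses. The range is wide
  enough that a union of two sets smaller than \<open>n / 4\<close> cannot jump over it.\<close>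

definition well_hit :: "nat \<Rightarrow> nat \<Rightarrow> clause list \<Rightarrow> bool" where
  "well_hit n j Cs \<longleftrightarrow> (\<forall>\<rho>\<in>assignments n. \<forall>Z. Z \<subseteq> {1..n} \<longrightarrow> n \<le> 4 * card Z \<longrightarrow> 4 * card Z \<le> 3 * n \<longrightarrow>
     set Cs \<inter> hit \<rho> Z ({1..n} - Z) j \<noteq> {})"

lemma well_hitE:
  assumes "well_hit n j Cs" "\<rho> \<in> assignments n" "Z \<subseteq> {1..n}" "n \<le> 4 * card Z" "4 * card Z \<le> 3 * n"
  obtains x V C where "C \<in> set Cs" "x \<in> Z" "V \<subseteq> {1..n} - Z"
    "C = insert (x, \<rho> x) ((\<lambda>y. (y, \<not> \<rho> y)) ` V)"
proof -
  have "set Cs \<inter> hit \<rho> Z ({1..n} - Z) j \<noteq> {}"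
    using assms unfolding well_hit_def by simp
  then obtain C where "C \<in> set Cs" "C \<in> hit \<rho> Z ({1..n} - Z) j" by blast
  then show ?thesis using that by (elim hitE) simp
qed

definition unfrozen :: "nat \<Rightarrow> clause list \<Rightarrow> nat set" where
  "unfrozen n Cs = {x \<in> {1..n}. \<exists>\<sigma>\<in>sols n Cs. \<exists>\<tau>\<in>sols n Cs. \<sigma> x \<noteq> \<tau> x}"

lemma assignments_eqI:
  assumes "\<sigma> \<in> assignments n" "\<tau> \<in> assignments n" "\<And>x. x \<in> {1..n} \<Longrightarrow> \<sigma> x = \<tau> x"
  shows "\<sigma> = \<tau>"
  using assms unfolding assignments_def by (rule PiE_ext)

text \<open>Otherwise choose \<open>Z\<close> inside the difference set and let
  \<open>\<rho>\<close> be \<open>\<sigma>\<close> on \<open>Z\<close> and \<open>\<tau>\<close>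
  elsewhere. A scanned clause hitting this pair is true under \<open>\<sigma>\<close>, while all its
  literals are false under \<open>\<tau>\<close>.\<close>

lemma sols_close:
  assumes hit: "well_hit n j Cs" and "n \<ge> 2" and \<sigma>: "\<sigma> \<in> sols n Cs" and \<tau>: "\<tau> \<in> sols n Cs"
  shows "4 * card {x \<in> {1..n}. \<sigma> x \<noteq> \<tau> x} < n"
proof (rule ccontr)
  let ?D = "{x \<in> {1..n}. \<sigma> x \<noteq> \<tau> x}"
  assume "\<not> 4 * card ?D < n"
  \<comment> \<open>This is \<open>n / 4\<close> rounded up; \<open>n \<ge> 2\<close> keeps it at
    most \<open>3 * n / 4\<close>.\<close>
  then have "(n + 3) div 4 \<le> card ?D" by linarith
  then obtain Z where Z: "Z \<subseteq> ?D" "card Z = (n + 3) div 4"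
    by (rule obtain_subset_with_card_n)
  have card: "n \<le> 4 * card Z" "4 * card Z \<le> 3 * n" using Z(2) \<open>n \<ge> 2\<close> by linarith+
  define \<rho> where "\<rho> = (\<lambda>x. if x \<in> Z then \<sigma> x else \<tau> x)"
  have "\<rho> \<in> assignments n"
    using \<sigma> \<tau> by (auto simp: \<rho>_def sols_def assignments_def PiE_iff extensional_def)
  moreover have "Z \<subseteq> {1..n}" using Z(1) by auto
  ultimately obtain x V C where C: "C \<in> set Cs" and xV: "x \<in> Z" "V \<subseteq> {1..n} - Z"
      "C = insert (x, \<rho> x) ((\<lambda>y. (y, \<not> \<rho> y)) ` V)"
    using well_hitE[OF hit _ _ card] by metis
  have "satisfies \<sigma> {C}" using xV by (auto simp: satisfies_def \<rho>_def)
  moreover have "\<not> satisfies \<tau> {C}" using xV Z(1) by (auto simp: satisfies_def \<rho>_def)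
  ultimately show False using sols_agree[OF \<sigma> \<tau> C] by blast
qed

text \<open>A union of difference sets can also not be of size between \<open>n/4\<close> and \<open>3n/4\<close>,
  and it grows by less than \<open>n/4\<close> with each survivor.\<close>

lemma card_unfrozen_lt:
  assumes hit: "well_hit n j Cs" and "n \<ge> 2"
  shows "4 * card (unfrozen n Cs) < n"
proof -
  obtain \<sigma> where \<sigma>: "\<sigma> \<in> sols n Cs" using sols_nonempty by blast
  define D where "D \<tau> = {x \<in> {1..n}. \<sigma> x \<noteq> \<tau> x}" for \<tau>
  have "finite S \<Longrightarrow> S \<subseteq> sols n Cs \<Longrightarrow> 4 * card (\<Union>\<tau>\<in>S. D \<tau>) < n" for S
  proof (induction S rule: finite_induct)
    case empty
    then show ?case using \<open>n \<ge> 2\<close> by simp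
  next
    case (insert \<tau> S)
    let ?Y = "\<Union>\<tau>\<in>insert \<tau> S. D \<tau>"
    have "card ?Y \<le> card (D \<tau>) + card (\<Union>\<tau>\<in>S. D \<tau>)" by (simp add: card_Un_le)
    moreover have "4 * card (D \<tau>) < n"
      unfolding D_def using hit \<open>n \<ge> 2\<close> \<sigma> insert.prems by (intro sols_close) auto
    moreover have "4 * card (\<Union>\<tau>\<in>S. D \<tau>) < n" using insert by simp
    ultimately have upper: "4 * card ?Y \<le> 3 * n" by linarith
    show ?case
    proof (rule ccontr)
      assume "\<not> 4 * card ?Y < n"
      then have lower: "n \<le> 4 * card ?Y" by simp
      have Y: "?Y \<subseteq> {1..n}" by (auto simp: D_def)
      \<comment> \<open>No mixed assignment is needed here: \<open>V\<close> avoids every difference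
        set, so each survivor considered agrees with \<open>\<sigma>\<close> on \<open>V\<close>,
        and one of them differs from it at \<open>x\<close>.\<close>
      have "\<sigma> \<in> assignments n" using \<sigma> by (simp add: sols_def)
      then obtain x V C where C: "C \<in> set Cs" and xV: "x \<in> ?Y" "V \<subseteq> {1..n} - ?Y"
          "C = insert (x, \<sigma> x) ((\<lambda>y. (y, \<not> \<sigma> y)) ` V)"
        by (rule well_hitE[OF hit _ Y lower upper])
      from xV(1) obtain \<upsilon> where \<upsilon>: "\<upsilon> \<in> insert \<tau> S" "x \<in> D \<upsilon>" by blast
      have "satisfies \<sigma> {C}" using xV by (auto simp: satisfies_def)
      moreover have "\<sigma> y = \<upsilon> y" if "y \<in> V" for y
      proof -
        have "y \<in> {1..n}" "y \<notin> D \<upsilon>" using that xV(2) \<upsilon>(1) by auto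
        then show ?thesis by (simp add: D_def)
      qed
      then have "\<not> satisfies \<upsilon> {C}" using xV(3) \<upsilon>(2) by (auto simp: satisfies_def D_def)
      moreover have "\<upsilon> \<in> sols n Cs" using \<upsilon>(1) insert.prems by auto
      ultimately show False using sols_agree[OF \<sigma> _ C] by blast
    qed
  qed
  from this[OF finite_sols order_refl] have "4 * card (\<Union>\<tau>\<in>sols n Cs. D \<tau>) < n" .
  \<comment> \<open>If two survivors disagree at a variable, one of them disagrees with
    \<open>\<sigma>\<close> there.\<close>
  moreover have "unfrozen n Cs = (\<Union>\<tau>\<in>sols n Cs. D \<tau>)"
  proof
    show "unfrozen n Cs \<subseteq> (\<Union>\<tau>\<in>sols n Cs. D \<tau>)"
      unfolding unfrozen_def D_def by auto
    show "(\<Union>\<tau>\<in>sols n Cs. D \<tau>) \<subseteq> unfrozen n Cs"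
    proof
      fix x assume "x \<in> (\<Union>\<tau>\<in>sols n Cs. D \<tau>)"
      then obtain \<tau> where "\<tau> \<in> sols n Cs" "x \<in> {1..n}" "\<sigma> x \<noteq> \<tau> x"
        unfolding D_def by blast
      with \<sigma> show "x \<in> unfrozen n Cs"
        unfolding unfrozen_def by (intro CollectI conjI bexI[of _ \<sigma>] bexI[of _ \<tau>])
    qed
  qed
  ultimately show ?thesis by simp
qed

definition freezing :: "nat \<Rightarrow> nat \<Rightarrow> nat \<Rightarrow> clause list \<Rightarrow> clause set" where
  "freezing n j x Cs =
     hit ((SOME \<sigma>. \<sigma> \<in> sols n Cs)(x := True)) {x} ({1..n} - unfrozen n Cs) j"

text \<open>A clause in the intersection would be satisfied by \<open>\<sigma>\<close> through
  \<open>x\<close> and falsified by \<open>\<tau>\<close>. Covering \<open>Cs\<close> as well as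
  \<open>Ds\<close> shows that the freezing clauses are still undrawn after the prefix, as the
  estimate for prefix-dependent targets demands.\<close>

lemma freezing_disjoint:
  assumes "\<sigma> \<in> sols n (Cs @ Ds)" "\<tau> \<in> sols n (Cs @ Ds)" "\<sigma> x" "\<not> \<tau> x" "x \<in> {1..n}"
  shows "x \<in> unfrozen n Cs" "set (Cs @ Ds) \<inter> freezing n j x Cs = {}"
proof -
  have \<sigma>\<tau>: "\<sigma> \<in> sols n Cs" "\<tau> \<in> sols n Cs"
    using assms(1,2) sols_append_subset by blast+
  then show x: "x \<in> unfrozen n Cs" using assms(3-5) by (auto simp: unfrozen_def)
  define \<rho> where "\<rho> = (SOME \<sigma>. \<sigma> \<in> sols n Cs)"
  have \<rho>: "\<rho> \<in> sols n Cs" unfolding \<rho>_def using sols_nonempty by (metis some_in_eq)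
  have False if C: "C \<in> set (Cs @ Ds)" "C \<in> freezing n j x Cs" for C
  proof -
    from C(2) obtain V where V: "V \<subseteq> {1..n} - unfrozen n Cs"
        "C = insert (x, True) ((\<lambda>y. (y, \<not> (\<rho>(x := True)) y)) ` V)"
      unfolding freezing_def \<rho>_def[symmetric] by (rule hitE) auto
    have "satisfies \<sigma> {C}" using V(2) assms(3) by (auto simp: satisfies_def)
    moreover have "\<tau> y = \<rho> y" "y \<noteq> x" if "y \<in> V" for y
    proof -
      have "y \<in> {1..n}" "y \<notin> unfrozen n Cs" using that V(1) by auto
      then show "\<tau> y = \<rho> y" "y \<noteq> x" using \<rho> \<sigma>\<tau> x by (auto simp: unfrozen_def)
    qed
    then have "\<not> satisfies \<tau> {C}" using V(2) assms(4) by (auto simp: satisfies_def)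
    ultimately show False using sols_agree[OF assms(1,2) C(1)] by blast
  qed
  then show "set (Cs @ Ds) \<inter> freezing n j x Cs = {}" by blast
qed

lemma not_unique_imp:
  assumes "\<not> (\<exists>!\<sigma>. \<sigma> \<in> sols n (Cs @ Ds))"
  obtains x where "x \<in> {1..n}" "x \<in> unfrozen n Cs" "set (Cs @ Ds) \<inter> freezing n j x Cs = {}"
proof -
  obtain \<sigma> \<tau> where \<sigma>\<tau>: "\<sigma> \<in> sols n (Cs @ Ds)" "\<tau> \<in> sols n (Cs @ Ds)" "\<sigma> \<noteq> \<tau>"
    using assms sols_nonempty[of n "Cs @ Ds"] by blast
  then obtain x where x: "x \<in> {1..n}" "\<sigma> x \<noteq> \<tau> x"
    using assignments_eqI[of \<sigma> n \<tau>] by (auto simp: sols_def)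
  \<comment> \<open>The literal at \<open>x\<close> is positive, so the survivor with value
    \<open>True\<close> has to play the first role.\<close>
  show ?thesis
  proof (cases "\<sigma> x")
    case True
    then show ?thesis using freezing_disjoint[OF \<sigma>\<tau>(1,2) _ _ x(1)] x that by blast
  next
    case False
    then show ?thesis using freezing_disjoint[OF \<sigma>\<tau>(2,1) _ _ x(1)] x that by blast
  qed
qed

section \<open>Probability estimates\<close>

lemma prob_not_well_hit_le:
  assumes "n \<ge> 2" "4 * Suc j \<le> n"
  shows "measure_pmf.prob (pmf_of_set (permutations_of_set (k_clauses n (Suc j))))
           {L. \<not> well_hit n j (take l L)} \<le> 4 ^ n * exp (- (hit_rate j / 4) * l)"
    (is "measure_pmf.prob ?M _ \<le> _")
proof -
  define I where "I = assignments n \<times> {Z. Z \<subseteq> {1..n} \<and> n \<le> 4 * card Z \<and> 4 * card Z \<le> 3 * n}"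
  define B where "B = (\<lambda>(\<rho>, Z). {L. set (take l L) \<inter> hit \<rho> Z ({1..n} - Z) j = {}})"
  have finZ: "finite {Z. Z \<subseteq> {1..n} \<and> n \<le> 4 * card Z \<and> 4 * card Z \<le> 3 * n}"
    by (rule finite_subset[of _ "Pow {1..n}"]) auto
  have finI: "finite I" unfolding I_def using finZ finite_assignments by blast
  have "card {Z. Z \<subseteq> {1..n} \<and> n \<le> 4 * card Z \<and> 4 * card Z \<le> 3 * n} \<le> card (Pow {1..n})"
    by (intro card_mono) auto
  then have "card I \<le> 2 ^ n * 2 ^ n"
    by (simp add: I_def card_cartesian_product assignments_def card_PiE card_Pow)
  then have cardI: "card I \<le> 4 ^ n" by (simp flip: power_mult_distrib)
  have N: "card (k_clauses n (Suc j)) > 0" using assms by (simp add: card_k_clauses)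
  have B: "measure_pmf.prob ?M (B i) \<le> exp (- (hit_rate j / 4) * l)" if i: "i \<in> I" for i
  proof -
    obtain \<rho> Z where \<rho>Z: "i = (\<rho>, Z)" by force
    have Z: "Z \<subseteq> {1..n}" "n \<le> 4 * card Z" "4 * card Z \<le> 3 * n" using i by (auto simp: \<rho>Z I_def)
    have "card ({1..n} - Z) = n - card Z" using Z(1) by (simp add: card_Diff_subset finite_subset)
    then have "hit_rate j * card Z / n * card (k_clauses n (Suc j)) \<le> card (hit \<rho> Z ({1..n} - Z) j)"
      using Z assms by (intro card_hit_ge) auto
    moreover have "hit_rate j / 4 \<le> hit_rate j * card Z / n"
      using Z(2) assms hit_rate_pos[of j] by (simp add: field_simps flip: of_nat_mult)
    then have "hit_rate j / 4 * card (k_clauses n (Suc j)) \<le> hit_rate j * card Z / n * card (k_clauses n (Suc j))"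
      by (rule mult_right_mono) simp
    ultimately have "hit_rate j / 4 * card (k_clauses n (Suc j)) \<le> card (hit \<rho> Z ({1..n} - Z) j)"
      by linarith
    \<comment> \<open>A fixed target is the case of an empty prefix, with \<open>Q\<close>
      expressing just that.\<close>
    then show ?thesis
      using prob_permutation_avoiding_later[of "k_clauses n (Suc j)" "hit_rate j / 4" "\<lambda>K. K = []"
          "\<lambda>_. hit \<rho> Z ({1..n} - Z) j" 0 l]
        finite_k_clauses N hit_rate_pos[of j] hit_subset_k_clauses[of Z n "{1..n} - Z" \<rho> j] Z(1)
      by (simp add: B_def \<rho>Z)
  qed
  have "{L. \<not> well_hit n j (take l L)} = (\<Union>i\<in>I. B i)"
    by (auto simp: well_hit_def I_def B_def)
  then have "measure_pmf.prob ?M {L. \<not> well_hit n j (take l L)} \<le> (\<Sum>i\<in>I. measure_pmf.prob ?M (B i))"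
    using finI by (auto intro!: measure_pmf.finite_measure_subadditive_finite)
  also have "\<dots> \<le> card I * exp (- (hit_rate j / 4) * l)"
    using sum_mono[OF B] by simp
  also have "\<dots> \<le> 4 ^ n * exp (- (hit_rate j / 4) * l)"
    using of_nat_mono[OF cardI, where 'a = real] by (intro mult_right_mono) auto
  finally show ?thesis .
qed

text \<open>A union bound over the variable left unfrozen. Given the prefix, its freezing clauses
  are a fraction of at least \<open>hit_rate j / n\<close> of all clauses, because more than
  \<open>3 * n / 4\<close> variables are frozen already.\<close>

lemma prob_not_frozen_le:
  assumes "n \<ge> 2" "4 * Suc j \<le> n"
  shows "measure_pmf.prob (pmf_of_set (permutations_of_set (k_clauses n (Suc j))))
           {L. well_hit n j (take l L) \<and> (\<exists>!\<sigma>. \<sigma> \<in> sols n (take (l + l') L)) = False}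
         \<le> n * exp (- (hit_rate j / n) * l')"
    (is "measure_pmf.prob ?M ?E \<le> _")
proof -
  \<comment> \<open>The first conjunct follows from \<open>well_hit\<close> and makes the target
    large; the last keeps the target disjoint from the prefix.\<close>
  define Q where "Q x K \<longleftrightarrow> 4 * card (unfrozen n K) < n \<and> x \<in> unfrozen n K \<and>
    set K \<inter> freezing n j x K = {}" for x K
  define B where "B x = {L. Q x (take l L) \<and>
    set (take l' (drop l L)) \<inter> freezing n j x (take l L) = {}}" for x
  have N: "card (k_clauses n (Suc j)) > 0" using assms by (simp add: card_k_clauses)
  have B: "measure_pmf.prob ?M (B x) \<le> exp (- (hit_rate j / n) * l')" for x
    unfolding B_def
  proof (rule prob_permutation_avoiding_later)
    fix K assume Q: "Q x K"
    have x: "x \<in> {1..n}" using Q by (auto simp: Q_def unfrozen_def)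
    have U: "unfrozen n K \<subseteq> {1..n}" by (auto simp: unfrozen_def)
    then have "card ({1..n} - unfrozen n K) = n - card (unfrozen n K)"
      by (simp add: card_Diff_subset finite_subset)
    then have "hit_rate j * card {x} / n * card (k_clauses n (Suc j)) \<le> card (freezing n j x K)"
      unfolding freezing_def using Q x assms by (intro card_hit_ge) (auto simp: Q_def)
    moreover have "freezing n j x K \<subseteq> k_clauses n (Suc j)"
      unfolding freezing_def using Q x by (intro hit_subset_k_clauses) (auto simp: Q_def)
    ultimately show "freezing n j x K \<subseteq> k_clauses n (Suc j) - set K \<and>
        hit_rate j / n * card (k_clauses n (Suc j)) \<le> card (freezing n j x K)"
      using Q by (auto simp: Q_def)
  qed (use finite_k_clauses N hit_rate_pos[of j] assms in auto)
  have "?E \<subseteq> (\<Union>x\<in>{1..n}. B x)"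
  proof
    fix L assume L: "L \<in> ?E"
    obtain x where "x \<in> {1..n}" "x \<in> unfrozen n (take l L)"
        "set (take l L @ take l' (drop l L)) \<inter> freezing n j x (take l L) = {}"
      using L not_unique_imp[of n "take l L" "take l' (drop l L)" j] by (auto simp: take_add)
    then show "L \<in> (\<Union>x\<in>{1..n}. B x)"
      using L card_unfrozen_lt[of n j "take l L"] assms(1) by (auto simp: B_def Q_def)
  qed
  then have "measure_pmf.prob ?M ?E \<le> measure_pmf.prob ?M (\<Union>x\<in>{1..n}. B x)"
    by (intro measure_pmf.finite_measure_mono) auto
  also have "\<dots> \<le> (\<Sum>x\<in>{1..n}. measure_pmf.prob ?M (B x))"
    by (intro measure_pmf.finite_measure_subadditive_finite) auto
  also have "\<dots> \<le> n * exp (- (hit_rate j / n) * l')"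
    using sum_mono[of "{1..n}", OF B] by simp
  finally show ?thesis .
qed

lemma prob_unique_ge:
  assumes "n \<ge> 2" "4 * Suc j \<le> n"
  shows "measure_pmf.prob (P_sat (Suc j) n m) {F. \<exists>!\<sigma>. \<sigma> \<in> assignments n \<and> satisfies \<sigma> F}
    \<ge> 1 - (4 ^ n * exp (- (hit_rate j / 4) * real (m div 2)) + n * exp (- (hit_rate j / n) * real (m - m div 2)))"
proof -
  let ?M = "pmf_of_set (permutations_of_set (k_clauses n (Suc j)))"
  let ?U = "{L. \<exists>!\<sigma>. \<sigma> \<in> sols n (take m L)}"
  let ?B1 = "{L. \<not> well_hit n j (take (m div 2) L)}"
  let ?B2 = "{L. well_hit n j (take (m div 2) L) \<and> (\<exists>!\<sigma>. \<sigma> \<in> sols n (take (m div 2 + (m - m div 2)) L)) = False}"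
  have "1 - measure_pmf.prob ?M ?U = measure_pmf.prob ?M (- ?U)"
    using measure_pmf.prob_compl[of ?U ?M] by (simp add: Compl_eq_Diff_UNIV)
  also have "\<dots> \<le> measure_pmf.prob ?M (?B1 \<union> ?B2)"
    by (intro measure_pmf.finite_measure_mono) auto
  also have "\<dots> \<le> measure_pmf.prob ?M ?B1 + measure_pmf.prob ?M ?B2"
    by (intro measure_Un_le) auto
  also have "\<dots> \<le> 4 ^ n * exp (- (hit_rate j / 4) * real (m div 2)) + n * exp (- (hit_rate j / n) * real (m - m div 2))"
    by (intro add_mono prob_not_well_hit_le prob_not_frozen_le assms)
  finally show ?thesis
    unfolding P_sat_def measure_map_pmf vimage_def by (simp add: sols_def del: of_nat_diff)
qed

section \<open>Choice of the constant and passage to the limit\<close>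

theorem corollary1:
  fixes k :: nat
  shows "\<exists>c::real. c > 0 \<and>
    (\<forall>m::nat \<Rightarrow> nat.
      (\<forall>\<^sub>F n in sequentially.
         m n \<le> 2 ^ k * (n choose k) \<and> real (m n) / real n \<ge> c * ln (real n)) \<longrightarrow>
      (\<lambda>n. measure_pmf.prob (P_sat k n (m n))
             {F. \<exists>!\<sigma>. \<sigma> \<in> assignments n \<and> satisfies \<sigma> F}) \<longlonglongrightarrow> 1)"
proof (cases k)
  case 0
  \<comment> \<open>There is only one clause of size 0, so the hypothesis would force
    \<open>ln n \<le> 1 / n\<close> eventually; the claim is vacuous.\<close>
  have "False" if "\<forall>\<^sub>F n in sequentially.
      m n \<le> 2 ^ k * (n choose k) \<and> real (m n) / real n \<ge> 1 * ln (real n)" for m :: "nat \<Rightarrow> nat"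
  proof -
    have "\<forall>\<^sub>F n in sequentially. ln (real n) > 1 / real n" by real_asymp
    with that have "\<forall>\<^sub>F n::nat in sequentially. False"
    proof eventually_elim
      case (elim n)
      then have "real (m n) / real n \<le> 1 / real n" by (intro divide_right_mono) (auto simp: 0)
      with elim show ?case by simp
    qed
    then show False by simp
  qed
  then show ?thesis by (intro exI[of _ 1]) auto
next
  case (Suc j)
  define g where "g = hit_rate j"
  have g: "g > 0" by (simp add: g_def hit_rate_pos)
  show ?thesis
  \<comment> \<open>With this constant \<open>g * m n \<ge> 4 * n * ln n\<close>, so half of the
    clauses contribute \<open>2 * n * ln n\<close> up to rounding. This beats the
    \<open>4 ^ n\<close> pairs and turns the bound over \<open>n\<close> variables into
    \<open>1 / n\<close>.\<close>
  proof (intro exI[of _ "4 / g"] conjI allI impI)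
    fix m :: "nat \<Rightarrow> nat"
    let ?p = "\<lambda>n. measure_pmf.prob (P_sat k n (m n)) {F. \<exists>!\<sigma>. \<sigma> \<in> assignments n \<and> satisfies \<sigma> F}"
    let ?e = "\<lambda>n::nat. 4 ^ n * exp (g / 4 - real n * ln n / 2) + n * exp (- 2 * ln n)"
    assume "\<forall>\<^sub>F n in sequentially. m n \<le> 2 ^ k * (n choose k) \<and> real (m n) / real n \<ge> 4 / g * ln n"
    moreover have "\<forall>\<^sub>F n in sequentially. n \<ge> max 2 (4 * Suc j)" by (rule eventually_ge_at_top)
    ultimately have "\<forall>\<^sub>F n in sequentially. 1 - ?e n \<le> ?p n"
    proof eventually_elim
      case (elim n)
      then have n: "n \<ge> 2" "4 * Suc j \<le> n" by auto
      have m: "4 * (real n * ln n) \<le> g * m n" using elim n g by (simp add: field_simps)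
      \<comment> \<open>The rounding loss in \<open>m n div 2\<close> produces the constant
        \<open>g / 4\<close> in the exponent of \<open>?e\<close>.\<close>
      have "real (m n) \<le> 2 * real (m n div 2) + 2" by linarith
      then have "g * m n \<le> g * (2 * real (m n div 2) + 2)" using g by simp
      then have 1: "- (g / 4) * real (m n div 2) \<le> g / 4 - real n * ln n / 2"
        using m by (simp add: algebra_simps)
      have "real (m n) \<le> 2 * real (m n - m n div 2)" by linarith
      then have "g * m n \<le> g * (2 * real (m n - m n div 2))" using g by (intro mult_left_mono) auto
      then have "2 * (real n * ln n) \<le> g * real (m n - m n div 2)"
        using m by (simp add: algebra_simps del: of_nat_diff)
      then have 2: "- (g / n) * real (m n - m n div 2) \<le> - 2 * ln n"
        using n by (simp add: field_simps del: of_nat_diff)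
      have "4 ^ n * exp (- (g / 4) * real (m n div 2)) + n * exp (- (g / n) * real (m n - m n div 2)) \<le> ?e n"
        using 1 2 by (intro add_mono mult_left_mono) auto
      with prob_unique_ge[OF n, of "m n"] show ?case unfolding Suc g_def by linarith
    qed
    moreover have "(\<lambda>n. 1 - ?e n) \<longlonglongrightarrow> 1" by real_asymp
    moreover have "\<forall>\<^sub>F n in sequentially. ?p n \<le> 1" by simp
    ultimately show "?p \<longlonglongrightarrow> 1" by (intro tendsto_sandwich[of _ ?p _ "\<lambda>_. 1"]) auto
  qed (use g in simp)
qed

end
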